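(* Assume $\sigma$-projective determinacy. Then every Menger space $X$ such that $X$ is a perfect preimage of a separable metrizable space and $\beta X\setminus X\in\mathscr{K}$ is $\sigma$-compact.
   Context: Spaces are completely regular. A perfect map is a continuous closed surjection with compact fibers. $\sigma$-projective sets: sets of reals in $\mathbf{\Sigma}^1_{\omega_1}$ of the transfinite projective hierarchy ($\mathbf{\Sigma}^1_1$ analytic; $\mathbf{\Pi}^1_\xi$ complements of $\mathbf{\Sigma}^1_\xi$; $\mathbf{\Sigma}^1_{\xi+1}$ continuous images of $\mathbf{\Pi}^1_\xi$; at limits, countable unions of earlier levels). $\sigma$-projective determinacy: all length-$\omega$ perfect-information games on $\omega$ with $\sigma$-projective payoff are determined. A multifunction $F:X\to\mathcal{P}(Y)$ is USCCV if each $F(x)$ is compact and $\{x:F(x)\cap C\ne\emptyset\}$ is closed for closed $C$; $\mathscr{K}$ is the class of images of $\sigma$-projective sets under surjective USCCV multifunctions. (In the paper such $X$ are called co-$\mathscr{K}$ $p$-spaces.) Menger: for every sequence $(\mathcal{U}_n)$ of open covers there are finite $\mathcal{V}_n\subseteq\mathcal{U}_n$ whose union is a cover. *)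

theory Defs
  imports "HOL-Analysis.Analysis"
begin

section \<open>The transfinite projective hierarchy\<close>

text \<open>The reals of descriptive set theory are the points of the Baire space; its topology is the
  product topology on \<^typ>\<open>nat \<Rightarrow> nat\<close> from the type class instances.\<close>

type_synonym baire = "nat \<Rightarrow> nat"

definition analytic_set :: "baire set \<Rightarrow> bool" where
  "analytic_set A \<longleftrightarrow> A = {} \<or> (\<exists>f :: baire \<Rightarrow> baire. continuous_on UNIV f \<and> A = range f)"

text \<open>A well-order of type \<open>\<omega>\<^sub>1\<close>; the elements of its field serve as the countable ordinals.\<close>

definition omega1 :: "nat set rel" where
  "omega1 = cardSuc natLeq"

definition imm_succ :: "nat set \<Rightarrow> nat set \<Rightarrow> bool" where
  "imm_succ \<eta> \<xi> \<longleftrightarrow> \<eta> \<in> Field omega1 \<and> \<xi> \<in> Field omega1 \<and> underS omega1 \<xi> = under omega1 \<eta>"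

text \<open>\<open>Sigma1 \<xi> A\<close> says that \<open>A\<close> is in the level of index \<open>1 + \<xi>\<close> of the hierarchy: the least
  element of \<^const>\<open>omega1\<close> stands for level 1, and the shift disappears from level \<open>\<omega>\<close> on.
  In the successor clause, \<open>- B\<close> being in the Sigma-class means that \<open>B\<close> is in the Pi-class.\<close>

inductive Sigma1 :: "nat set \<Rightarrow> baire set \<Rightarrow> bool" where
  first: "\<lbrakk>\<xi> \<in> Field omega1; underS omega1 \<xi> = {}; analytic_set A\<rbrakk> \<Longrightarrow> Sigma1 \<xi> A"
| succ: "\<lbrakk>imm_succ \<eta> \<xi>; Sigma1 \<eta> (- B); continuous_on B f\<rbrakk> \<Longrightarrow> Sigma1 \<xi> (f ` B)"
| limit: "\<lbrakk>\<xi> \<in> Field omega1; underS omega1 \<xi> \<noteq> {}; \<forall>\<eta>. \<not> imm_succ \<eta> \<xi>;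
           \<forall>n::nat. \<exists>\<eta> \<in> underS omega1 \<xi>. Sigma1 \<eta> (A n)\<rbrakk> \<Longrightarrow> Sigma1 \<xi> (\<Union>n. A n)"

text \<open>This is the limit clause once more, at level \<open>\<omega>\<^sub>1\<close> itself.\<close>

definition sigma_projective :: "baire set \<Rightarrow> bool" where
  "sigma_projective A \<longleftrightarrow>
     (\<exists>B :: nat \<Rightarrow> baire set. (\<forall>n. \<exists>\<xi> \<in> Field omega1. Sigma1 \<xi> (B n)) \<and> A = (\<Union>n. B n))"

lemma Well_order_omega1: "Well_order omega1"
  unfolding omega1_def
  using cardSuc_Card_order[OF natLeq_Card_order] card_order_on_well_order_on by blast

lemma uncountable_Field_omega1:
  includes cardinal_syntax
  shows "\<not> countable (Field omega1)"
proof
  assume "countable (Field omega1)"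
  then obtain f :: "nat set \<Rightarrow> nat" where "inj_on f (Field omega1)"
    by (rule countableE)
  then have "|Field omega1| \<le>o |UNIV :: nat set|"
    by (rule card_of_ordLeqI) simp
  moreover have "|Field omega1| =o omega1"
    unfolding omega1_def by (simp add: cardSuc_Card_order card_of_Field_ordIso natLeq_Card_order)
  moreover have "|UNIV :: nat set| =o natLeq"
    by (rule card_of_nat)
  ultimately have "omega1 \<le>o natLeq"
    using ordIso_ordLeq_trans[OF ordIso_symmetric] ordLeq_ordIso_trans by blast
  moreover have "natLeq <o omega1"
    unfolding omega1_def by (rule cardSuc_greater[OF natLeq_Card_order])
  ultimately show False
    using not_ordLess_ordLeq by blast
qed


section \<open>Determinacy\<close>

text \<open>Players I and II alternately play natural numbers, I choosing the moves of even index.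
  Strategies read the finite sequence of all previous moves. I wins iff the play is in \<open>A\<close>.\<close>

definition winning_I :: "baire set \<Rightarrow> (nat list \<Rightarrow> nat) \<Rightarrow> bool" where
  "winning_I A s \<longleftrightarrow>
     (\<forall>x :: baire. (\<forall>n. x (2 * n) = s (map x [0..<2 * n])) \<longrightarrow> x \<in> A)"

definition winning_II :: "baire set \<Rightarrow> (nat list \<Rightarrow> nat) \<Rightarrow> bool" where
  "winning_II A t \<longleftrightarrow>
     (\<forall>x :: baire. (\<forall>n. x (2 * n + 1) = t (map x [0..<2 * n + 1])) \<longrightarrow> x \<notin> A)"

definition determined :: "baire set \<Rightarrow> bool" where
  "determined A \<longleftrightarrow> (\<exists>s. winning_I A s) \<or> (\<exists>t. winning_II A t)"

definition sigma_projective_determinacy :: bool where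
  "sigma_projective_determinacy \<longleftrightarrow> (\<forall>A. sigma_projective A \<longrightarrow> determined A)"


section \<open>Multifunctions and the class \<open>\<K>\<close>\<close>

definition USCCV :: "'a topology \<Rightarrow> 'b topology \<Rightarrow> ('a \<Rightarrow> 'b set) \<Rightarrow> bool" where
  "USCCV X Y F \<longleftrightarrow>
     (\<forall>x \<in> topspace X. compactin Y (F x)) \<and>
     (\<forall>C. closedin Y C \<longrightarrow> closedin X {x \<in> topspace X. F x \<inter> C \<noteq> {}})"

definition class_K :: "'b topology \<Rightarrow> bool" where
  "class_K Y \<longleftrightarrow>
     (\<exists>A F. sigma_projective A \<and> USCCV (top_of_set A) Y F \<and> (\<Union>x\<in>A. F x) = topspace Y)"


section \<open>The Stone-Cech compactification\<close>

text \<open>Functions in the index set are normalised to be undefined off the space, so that it is the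
  set of continuous functions from \<open>X\<close> to the unit interval without repetitions.\<close>

definition unit_functions :: "'a topology \<Rightarrow> ('a \<Rightarrow> real) set" where
  "unit_functions X =
     {f \<in> extensional (topspace X). continuous_map X (top_of_set {0..1}) f}"

definition unit_cube :: "'a topology \<Rightarrow> (('a \<Rightarrow> real) \<Rightarrow> real) topology" where
  "unit_cube X = product_topology (\<lambda>f. top_of_set {0..1}) (unit_functions X)"

definition beta_embedding :: "'a topology \<Rightarrow> 'a \<Rightarrow> ('a \<Rightarrow> real) \<Rightarrow> real" where
  "beta_embedding X x = (\<lambda>f \<in> unit_functions X. f x)"

definition Stone_Cech :: "'a topology \<Rightarrow> (('a \<Rightarrow> real) \<Rightarrow> real) topology" where
  "Stone_Cech X =
     subtopology (unit_cube X) (unit_cube X closure_of (beta_embedding X ` topspace X))"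

definition Stone_Cech_remainder :: "'a topology \<Rightarrow> (('a \<Rightarrow> real) \<Rightarrow> real) topology" where
  "Stone_Cech_remainder X =
     subtopology (Stone_Cech X) (topspace (Stone_Cech X) - beta_embedding X ` topspace X)"

lemma unit_functions_eq:
  "unit_functions X = mspace (submetric (cfunspace X euclidean_metric) {f. f \<in> topspace X \<rightarrow> {0..1}})"
proof -
  have "bounded (f ` topspace X)" if "f \<in> topspace X \<rightarrow> {0..1::real}" for f
    using that by (metis bounded_closed_interval bounded_subset image_subset_iff_funcset)
  then show ?thesis
    unfolding unit_functions_def mspace_submetric mspace_cfunspace continuous_map_in_subtopology
    by (auto simp: image_subset_iff_funcset[symmetric])
qed

lemma compact_space_unit_cube: "compact_space (unit_cube X)"
  unfolding unit_cube_def compact_space_product_topology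
  by (intro disjI2 ballI compact_space_subtopology) (simp add: compactin_euclidean_iff)

lemma Hausdorff_space_unit_cube: "Hausdorff_space (unit_cube X)"
  unfolding unit_cube_def Hausdorff_space_product_topology
  by (intro disjI2 ballI Hausdorff_space_subtopology Hausdorff_space_euclidean)

lemma compact_space_Stone_Cech: "compact_space (Stone_Cech X)"
  unfolding Stone_Cech_def
  by (intro compact_space_subtopology closedin_compact_space compact_space_unit_cube closedin_closure_of)

lemma Hausdorff_space_Stone_Cech: "Hausdorff_space (Stone_Cech X)"
  unfolding Stone_Cech_def by (intro Hausdorff_space_subtopology Hausdorff_space_unit_cube)

lemma beta_embedding_in_cube: "beta_embedding X ` topspace X \<subseteq> topspace (unit_cube X)"
proof (rule image_subsetI)
  fix x assume x: "x \<in> topspace X"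
  have "f x \<in> {0..1}" if "f \<in> unit_functions X" for f
    using that x continuous_map_image_subset_topspace[of X "top_of_set {0..1}" f]
    by (auto simp: unit_functions_def simp del: atLeastAtMost_iff)
  then show "beta_embedding X x \<in> topspace (unit_cube X)"
    unfolding beta_embedding_def unit_cube_def by (simp add: PiE_iff)
qed

lemma embedding_map_Stone_Cech:
  assumes "completely_regular_space X" "Hausdorff_space X"
  shows "embedding_map X (Stone_Cech X) (beta_embedding X)"
proof -
  have "embedding_map X (unit_cube X) (beta_embedding X)"
    using completely_regular_space_cube_embedding_explicit[OF assms]
    unfolding unit_cube_def beta_embedding_def[abs_def] unit_functions_eq .
  then show ?thesis
    unfolding Stone_Cech_def
    by (simp add: embedding_map_in_subtopology closure_of_subset beta_embedding_in_cube)
qed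

lemma dense_Stone_Cech:
  "Stone_Cech X closure_of (beta_embedding X ` topspace X) = topspace (Stone_Cech X)"
proof -
  let ?E = "beta_embedding X ` topspace X" and ?C = "unit_cube X"
  have "?E \<subseteq> ?C closure_of ?E"
    by (rule closure_of_subset[OF beta_embedding_in_cube])
  then have "Stone_Cech X closure_of ?E = ?C closure_of ?E"
    unfolding Stone_Cech_def closure_of_subtopology by (simp add: Int_absorb1)
  also have "\<dots> = topspace (Stone_Cech X)"
    unfolding Stone_Cech_def using closure_of_subset_topspace[of ?C ?E] by auto
  finally show ?thesis .
qed

lemma Stone_Cech_extension:
  assumes "f \<in> unit_functions X"
  shows "\<exists>g. continuous_map (Stone_Cech X) (top_of_set {0..1}) g \<and>
             (\<forall>x \<in> topspace X. g (beta_embedding X x) = f x)"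
proof (intro exI conjI ballI)
  show "continuous_map (Stone_Cech X) (top_of_set {0..1}) (\<lambda>z. z f)"
    unfolding Stone_Cech_def unit_cube_def
    by (intro continuous_map_from_subtopology continuous_map_product_projection assms)
qed (use assms in \<open>simp add: beta_embedding_def\<close>)


section \<open>Covering properties\<close>

definition Menger_space :: "'a topology \<Rightarrow> bool" where
  "Menger_space X \<longleftrightarrow>
     (\<forall>\<U> :: nat \<Rightarrow> 'a set set.
        (\<forall>n. (\<forall>U \<in> \<U> n. openin X U) \<and> \<Union>(\<U> n) = topspace X) \<longrightarrow>
        (\<exists>\<V>. (\<forall>n. finite (\<V> n) \<and> \<V> n \<subseteq> \<U> n) \<and> \<Union>(\<Union>n. \<V> n) = topspace X))"

definition sigma_compact_space :: "'a topology \<Rightarrow> bool" where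
  "sigma_compact_space X \<longleftrightarrow>
     (\<exists>K :: nat \<Rightarrow> 'a set. (\<forall>n. compactin X (K n)) \<and> (\<Union>n. K n) = topspace X)"

end

theory Submission
  imports Defs "HOL-Library.Countable_Set_Type"
begin

text \<open>
  The Stone-Cech compactification \<open>Y\<close> of \<open>X\<close> carries countably many continuous functions, pulled
  back from bump functions on the separable metrizable space, that separate points of \<open>X\<close> from
  points of the remainder. Covering \<open>Y\<close> for each of these functions by the closed sets where it is
  at most 2/3 and at least 1/3, every 0-1-sequence \<open>z\<close> defines a closed cell of \<open>Y\<close>, which lies in
  \<open>X\<close> or in the remainder.

  Consider the game where I produces a sequence \<open>x\<close>, II produces \<open>z\<close>, and II has to make the
  cell of \<open>z\<close> meet the remainder if \<open>x\<close> is eventually zero and meet \<open>X\<close> otherwise. Its payoff is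
  \<open>\<sigma>\<close>-projective because the remainder is in the class \<open>\<K>\<close>. A winning strategy for I is a
  continuous function pulling back the eventually zero sequences, a countable union of closed
  sets, to the codes of the cells in \<open>X\<close>, so \<open>X\<close> is \<open>\<sigma>\<close>-compact. A winning strategy for II is an
  upper semicontinuous map from 0-1-sequences to cells under which exactly the sequences with
  infinitely many ones go into \<open>X\<close>; as these do not form a Menger space, neither does \<open>X\<close>.
\<close>

section \<open>Countable ordinals\<close>

interpretation omega1: wo_rel omega1
  using Well_order_omega1 by (simp add: wo_rel_def)

lemma omega1_antisym: "(a, b) \<in> omega1 \<Longrightarrow> (b, a) \<in> omega1 \<Longrightarrow> a = b"
  using omega1.ANTISYM by (rule antisymD)

lemma omega1_trans: "(a, b) \<in> omega1 \<Longrightarrow> (b, c) \<in> omega1 \<Longrightarrow> (a, c) \<in> omega1"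
  using omega1.TRANS by (rule transD)

lemma under_omega1_refl: "a \<in> Field omega1 \<Longrightarrow> a \<in> under omega1 a"
  using omega1.REFL by (simp add: under_def refl_on_def)

lemma not_under_omega1:
  "\<lbrakk>a \<in> Field omega1; b \<in> Field omega1; a \<notin> under omega1 b\<rbrakk> \<Longrightarrow> b \<in> underS omega1 a"
  using omega1.TOTALS by (auto simp: under_def underS_def)

lemma countable_under_omega1: "countable (under omega1 \<xi>)"
proof (cases "\<xi> \<in> Field omega1")
  case True
  include cardinal_syntax
  have "|underS omega1 \<xi>| <o omega1"
    using True unfolding omega1_def
    by (intro card_of_underS) (simp_all add: cardSuc_Card_order natLeq_Card_order)
  then have "|underS omega1 \<xi>| \<le>o natLeq"
    unfolding omega1_def
    by (simp add: cardSuc_ordLess_ordLeq cardSuc_ordLeq_ordLess natLeq_Card_order card_of_Card_order)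
  then have "|underS omega1 \<xi>| \<le>o |UNIV :: nat set|"
    using card_of_nat ordIso_symmetric ordLeq_ordIso_trans by blast
  then have "countable (underS omega1 \<xi>)"
    using countable_card_of_nat by blast
  moreover have "under omega1 \<xi> \<subseteq> insert \<xi> (underS omega1 \<xi>)"
    by (auto simp: under_def underS_def)
  ultimately show ?thesis
    by (meson countable_insert countable_subset)
next
  case False
  then have "under omega1 \<xi> = {}"
    by (auto simp: under_def Field_def)
  then show ?thesis by simp
qed

text \<open>The countably many countable segments below the members of \<open>T\<close> cannot
  exhaust the uncountable field; by linearity, a point outside all of them is strictly above
  \<open>T\<close>.\<close>

lemma countable_strictly_bounded_omega1:
  assumes "countable T" "T \<subseteq> Field omega1"
  shows "\<exists>\<xi> \<in> Field omega1. T \<subseteq> underS omega1 \<xi>"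
proof -
  have "countable (\<Union>\<eta>\<in>T. under omega1 \<eta>)"
    using assms(1) countable_under_omega1 by blast
  then obtain \<xi> where \<xi>: "\<xi> \<in> Field omega1" "\<xi> \<notin> (\<Union>\<eta>\<in>T. under omega1 \<eta>)"
    using uncountable_Field_omega1 by (meson countable_subset subsetI)
  have "\<eta> \<in> underS omega1 \<xi>" if "\<eta> \<in> T" for \<eta>
    using \<xi> that assms(2) not_under_omega1 by blast
  then show ?thesis
    using \<xi>(1) by blast
qed

lemma ex_imm_succ:
  assumes "\<eta> \<in> Field omega1"
  shows "\<exists>\<xi>. imm_succ \<eta> \<xi>"
proof -
  let ?B = "{\<xi> \<in> Field omega1. \<eta> \<in> underS omega1 \<xi>}"
  let ?m = "omega1.minim ?B"
  have ne: "?B \<noteq> {}"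
    using countable_strictly_bounded_omega1[of "{\<eta>}"] assms by auto
  have m: "?m \<in> ?B"
    using omega1.minim_in[of ?B] ne by blast
  have least: "(?m, b) \<in> omega1" if "b \<in> ?B" for b
    using omega1.minim_least[of ?B b] that by blast
  have "underS omega1 ?m = under omega1 \<eta>"
  proof (intro equalityI subsetI)
    fix \<zeta> assume \<zeta>: "\<zeta> \<in> underS omega1 ?m"
    then have F: "\<zeta> \<in> Field omega1"
      by (auto simp: underS_def Field_def)
    show "\<zeta> \<in> under omega1 \<eta>"
    proof (rule ccontr)
      assume "\<zeta> \<notin> under omega1 \<eta>"
      then have "\<zeta> \<in> ?B"
        using F assms not_under_omega1 by blast
      then have "(?m, \<zeta>) \<in> omega1"
        by (rule least)
      then show False
        using \<zeta> omega1_antisym unfolding underS_def by blast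
    qed
  next
    fix \<zeta> assume "\<zeta> \<in> under omega1 \<eta>"
    then show "\<zeta> \<in> underS omega1 ?m"
      using m omega1_trans omega1_antisym unfolding under_def underS_def by blast
  qed
  then show ?thesis
    using m assms unfolding imm_succ_def by blast
qed

text \<open>The given indices are closed under a choice \<open>s\<close> of successors; the least
  strict upper bound of the resulting set is no successor.\<close>

lemma ex_limit_above:
  fixes \<xi> :: "nat \<Rightarrow> nat set"
  assumes "\<And>n. \<xi> n \<in> Field omega1"
  shows "\<exists>l \<in> Field omega1. range \<xi> \<subseteq> underS omega1 l \<and> (\<forall>\<eta>. \<not> imm_succ \<eta> l)"
proof -
  obtain s where s: "\<And>\<eta>. \<eta> \<in> Field omega1 \<Longrightarrow> imm_succ \<eta> (s \<eta>)"
    using ex_imm_succ by metis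
  define T where "T = (\<Union>n k. {(s ^^ k) (\<xi> n)})"
  have F: "(s ^^ k) (\<xi> n) \<in> Field omega1" for k n
    by (induction k) (use assms s in \<open>auto simp: imm_succ_def\<close>)
  have Ts: "s t \<in> T" if "t \<in> T" for t
  proof -
    obtain n k where "t = (s ^^ k) (\<xi> n)"
      using \<open>t \<in> T\<close> unfolding T_def by blast
    then have "s t = (s ^^ Suc k) (\<xi> n)"
      by simp
    then show ?thesis
      unfolding T_def by blast
  qed
  have T: "countable T" "T \<subseteq> Field omega1"
    using F unfolding T_def by auto
  let ?B = "{l \<in> Field omega1. T \<subseteq> underS omega1 l}"
  let ?m = "omega1.minim ?B"
  have ne: "?B \<noteq> {}"
    using countable_strictly_bounded_omega1[OF T] by auto
  have m: "?m \<in> ?B"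
    using omega1.minim_in[of ?B] ne by blast
  have least: "(?m, b) \<in> omega1" if "b \<in> ?B" for b
    using omega1.minim_least[of ?B b] that by blast
  have "\<not> imm_succ \<eta> ?m" for \<eta>
  proof
    assume "imm_succ \<eta> ?m"
    then have \<eta>: "\<eta> \<in> Field omega1" "underS omega1 ?m = under omega1 \<eta>"
      by (auto simp: imm_succ_def)
    have "\<eta> \<in> underS omega1 ?m"
      using \<eta> under_omega1_refl by simp
    \<comment> \<open>Minimality of \<open>?m\<close> gives a member of \<open>T\<close> that is not
      strictly below \<eta>, and this must be \<eta> itself; then \<open>s \<eta>\<close> is in
      \<open>T\<close> as well, hence at most \<eta>, which is absurd.\<close>
    then have "\<eta> \<notin> ?B"
      using least[of \<eta>] omega1_antisym unfolding underS_def by blast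
    then obtain t where t: "t \<in> T" "t \<notin> underS omega1 \<eta>"
      using \<eta>(1) by blast
    then have "t = \<eta>"
      using m \<eta>(2) unfolding under_def underS_def by blast
    with Ts[OF t(1)] have "(s \<eta>, \<eta>) \<in> omega1"
      using m \<eta>(2) unfolding under_def by blast
    moreover have "\<eta> \<in> underS omega1 (s \<eta>)"
      using s[OF \<eta>(1)] \<eta>(1) under_omega1_refl by (simp add: imm_succ_def)
    ultimately show False
      using omega1_antisym unfolding underS_def by blast
  qed
  moreover have "range \<xi> \<subseteq> T"
  proof
    fix \<eta> assume "\<eta> \<in> range \<xi>"
    then obtain n where "\<eta> = (s ^^ 0) (\<xi> n)"
      by auto
    then show "\<eta> \<in> T"
      unfolding T_def by blast
  qed
  ultimately show ?thesis
    using m by blast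
qed


section \<open>Closure properties of the \<open>\<sigma>\<close>-projective sets\<close>

text \<open>The limit clause asks each set only for some level below the limit index, so any limit
  index above the countably many given levels works.\<close>

lemma Sigma1_UN:
  assumes "\<And>n::nat. \<exists>\<xi> \<in> Field omega1. Sigma1 \<xi> (A n)"
  shows "\<exists>\<xi> \<in> Field omega1. Sigma1 \<xi> (\<Union>n. A n)"
proof -
  obtain \<xi> where \<xi>: "\<And>n. \<xi> n \<in> Field omega1" "\<And>n. Sigma1 (\<xi> n) (A n)"
    using assms by metis
  obtain l where l: "l \<in> Field omega1" "range \<xi> \<subseteq> underS omega1 l" "\<forall>\<eta>. \<not> imm_succ \<eta> l"
    using ex_limit_above[of \<xi>] \<xi>(1) by blast
  then have "Sigma1 l (\<Union>n. A n)"
    using \<xi>(2) by (intro Sigma1.limit) auto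
  then show ?thesis
    using l(1) by blast
qed

text \<open>Level \<open>\<omega>\<^sub>1\<close> adds no sets to the earlier levels: a union of
  countably many sets from countable levels already appears at a countable limit level.\<close>

lemma sigma_projective_iff_Sigma1:
  "sigma_projective A \<longleftrightarrow> (\<exists>\<xi> \<in> Field omega1. Sigma1 \<xi> A)"
proof
  assume "sigma_projective A"
  then show "\<exists>\<xi> \<in> Field omega1. Sigma1 \<xi> A"
    unfolding sigma_projective_def using Sigma1_UN by blast
next
  assume "\<exists>\<xi> \<in> Field omega1. Sigma1 \<xi> A"
  then show "sigma_projective A"
    unfolding sigma_projective_def by (intro exI[of _ "\<lambda>_. A"]) simp
qed

lemma sigma_projective_UN:
  "(\<And>n::nat. sigma_projective (A n)) \<Longrightarrow> sigma_projective (\<Union>n. A n)"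
  unfolding sigma_projective_iff_Sigma1 by (rule Sigma1_UN)

lemma sigma_projective_analytic:
  assumes "analytic_set A"
  shows "sigma_projective A"
proof -
  let ?m = "omega1.minim (Field omega1)"
  have ne: "Field omega1 \<noteq> {}"
    using uncountable_Field_omega1 by auto
  have m: "?m \<in> Field omega1"
    using omega1.minim_in ne by blast
  have "underS omega1 ?m = {}"
    using omega1.minim_least[of "Field omega1"] omega1_antisym
    unfolding underS_def Field_def by blast
  then have "Sigma1 ?m A"
    using m assms by (intro Sigma1.first)
  then show ?thesis
    using m unfolding sigma_projective_iff_Sigma1 by blast
qed

lemma sigma_projective_image_Compl:
  assumes "sigma_projective (- B)" "continuous_on B f"
  shows "sigma_projective (f ` B)"
proof -
  obtain \<eta> where "\<eta> \<in> Field omega1" "Sigma1 \<eta> (- B)"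
    using assms(1) unfolding sigma_projective_iff_Sigma1 by blast
  moreover obtain \<xi> where "imm_succ \<eta> \<xi>"
    using ex_imm_succ calculation(1) by blast
  ultimately have "Sigma1 \<xi> (f ` B)" "\<xi> \<in> Field omega1"
    using assms(2) Sigma1.succ by (auto simp: imm_succ_def)
  then show ?thesis
    unfolding sigma_projective_iff_Sigma1 by blast
qed

text \<open>The successor clause for the identity map puts the complement of a set into the next
  level.\<close>

lemma sigma_projective_Compl:
  assumes "sigma_projective A"
  shows "sigma_projective (- A)"
  using sigma_projective_image_Compl[of "- A" "\<lambda>x. x"] assms by simp

lemma sigma_projective_image:
  assumes "sigma_projective A" "continuous_on A f"
  shows "sigma_projective (f ` A)"
  using sigma_projective_image_Compl sigma_projective_Compl assms by blast

lemma sigma_projective_INT: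
  assumes "\<And>n::nat. sigma_projective (A n)"
  shows "sigma_projective (\<Inter>n. A n)"
  using sigma_projective_Compl[OF sigma_projective_UN[of "\<lambda>n. - A n"]] assms
  by (simp add: sigma_projective_Compl)

lemma sigma_projective_Un:
  assumes "sigma_projective A" "sigma_projective B"
  shows "sigma_projective (A \<union> B)"
proof -
  have "sigma_projective (\<Union>n::nat. if n = 0 then A else B)"
    by (rule sigma_projective_UN) (simp add: assms)
  also have "(\<Union>n::nat. if n = 0 then A else B) = A \<union> B"
    by (auto split: if_splits)
  finally show ?thesis .
qed

lemma sigma_projective_Int:
  assumes "sigma_projective A" "sigma_projective B"
  shows "sigma_projective (A \<inter> B)"
  using sigma_projective_Compl[OF sigma_projective_Un[of "- A" "- B"]] assms
  by (simp add: sigma_projective_Compl)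

section \<open>Basic open sets of the Baire space; open and closed sets\<close>

definition cylinder :: "nat list \<Rightarrow> baire set" where
  "cylinder l = {x. map x [0..<length l] = l}"

lemma cylinder_iff: "x \<in> cylinder l \<longleftrightarrow> (\<forall>i<length l. x i = l ! i)"
  unfolding cylinder_def mem_Collect_eq list_eq_iff_nth_eq by simp

lemma open_cylinder: "open (cylinder l)"
proof -
  have "cylinder l = (\<Inter>i\<in>{..<length l}. (\<lambda>x. x i) -` {l ! i})"
    by (auto simp: cylinder_iff)
  then show ?thesis
    by (simp add: open_INT open_vimage open_discrete)
qed

lemma open_baire_cylinder:
  fixes U :: "baire set"
  assumes "open U" "x \<in> U"
  shows "\<exists>n. cylinder (map x [0..<n]) \<subseteq> U"
proof -
  have "openin (product_topology (\<lambda>i::nat. euclidean :: nat topology) UNIV) U"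
    using assms(1) by (simp add: euclidean_product_topology)
  from product_topology_open_contains_basis[OF this assms(2)]
  obtain V where V: "x \<in> (\<Pi>\<^sub>E i\<in>UNIV. V i)" "finite {i. V i \<noteq> UNIV}" "(\<Pi>\<^sub>E i\<in>UNIV. V i) \<subseteq> U"
    by auto
  obtain n where n: "\<And>i. V i \<noteq> UNIV \<Longrightarrow> i < n"
    using V(2) finite_nat_set_iff_bounded by auto
  have "cylinder (map x [0..<n]) \<subseteq> (\<Pi>\<^sub>E i\<in>UNIV. V i)"
  proof
    fix y assume y: "y \<in> cylinder (map x [0..<n])"
    have "y i \<in> V i" for i
    proof (cases "i < n")
      case True
      then have "y i = x i"
        using y by (simp add: cylinder_iff)
      then show ?thesis
        using V(1) by (simp add: PiE_iff)
    next
      case False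
      then show ?thesis
        using n by blast
    qed
    then show "y \<in> (\<Pi>\<^sub>E i\<in>UNIV. V i)"
      by (simp add: PiE_iff)
  qed
  then show ?thesis
    using V(3) by blast
qed

text \<open>Overwriting the first \<open>length l\<close> coordinates by \<open>l\<close> is a
  continuous retraction onto the cylinder, which is therefore analytic.\<close>

lemma sigma_projective_cylinder: "sigma_projective (cylinder l)"
proof -
  define f :: "baire \<Rightarrow> baire" where "f y i = (if i < length l then l ! i else y i)" for y i
  have "continuous_on UNIV f"
  proof (rule continuous_on_coordinatewise_then_product)
    show "continuous_on UNIV (\<lambda>y. f y i)" for i
      by (cases "i < length l") (simp_all add: f_def)
  qed
  moreover have "cylinder l = range f"
  proof (intro equalityI subsetI)
    fix x assume x: "x \<in> cylinder l"
    then have "x = f x"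
      by (auto simp: f_def cylinder_iff)
    then show "x \<in> range f"
      by blast
  next
    fix x assume "x \<in> range f"
    then show "x \<in> cylinder l"
      by (auto simp: f_def cylinder_iff)
  qed
  ultimately show ?thesis
    by (intro sigma_projective_analytic) (auto simp: analytic_set_def)
qed

lemma sigma_projective_open:
  assumes "open U"
  shows "sigma_projective U"
proof -
  let ?A = "\<lambda>n. if cylinder (from_nat n) \<subseteq> U then cylinder (from_nat n) else {}"
  have "x \<in> (\<Union>n. ?A n)" if x: "x \<in> U" for x
  proof -
    obtain k where "cylinder (map x [0..<k]) \<subseteq> U"
      using open_baire_cylinder[OF assms x] by blast
    moreover have "x \<in> cylinder (map x [0..<k])"
      by (simp add: cylinder_iff)
    ultimately have "x \<in> ?A (to_nat (map x [0..<k]))"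
      by simp
    then show ?thesis
      by blast
  qed
  then have "U = (\<Union>n. ?A n)"
    by (auto split: if_splits)
  moreover have "sigma_projective (?A n)" for n
    by (simp add: sigma_projective_cylinder sigma_projective_analytic analytic_set_def)
  ultimately show ?thesis
    using sigma_projective_UN[of ?A] by simp
qed

lemma sigma_projective_closed: "closed C \<Longrightarrow> sigma_projective C"
  using sigma_projective_Compl[OF sigma_projective_open[of "- C"]] by (simp add: open_Compl)

lemma sigma_projective_closedin:
  assumes "sigma_projective A" "closedin (top_of_set A) C"
  shows "sigma_projective C"
  using assms sigma_projective_Int sigma_projective_closed by (auto simp: closedin_closed)

section \<open>Coding pairs of sequences by sequences; continuous preimages\<close>

definition moves_I :: "baire \<Rightarrow> baire" where
  "moves_I w = (\<lambda>n. w (2 * n))"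

definition moves_II :: "baire \<Rightarrow> baire" where
  "moves_II w = (\<lambda>n. w (2 * n + 1))"

definition interleave :: "baire \<Rightarrow> baire \<Rightarrow> baire" where
  "interleave x y = (\<lambda>n. if even n then x (n div 2) else y (n div 2))"

lemma moves_interleave [simp]: "moves_I (interleave x y) = x" "moves_II (interleave x y) = y"
  by (auto simp: moves_I_def moves_II_def interleave_def)

lemma continuous_on_moves_I [continuous_intros]:
  "continuous_on S f \<Longrightarrow> continuous_on S (\<lambda>x. moves_I (f x))"
  unfolding moves_I_def
  using continuous_on_product_then_coordinatewise[of S f]
  by (intro continuous_on_coordinatewise_then_product) blast

lemma continuous_on_moves_II [continuous_intros]:
  "continuous_on S f \<Longrightarrow> continuous_on S (\<lambda>x. moves_II (f x))"
  unfolding moves_II_def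
  using continuous_on_product_then_coordinatewise[of S f]
  by (intro continuous_on_coordinatewise_then_product) blast

text \<open>The preimage is the projection of \<open>{(x, y). y \<in> B \<and> f x = g y}\<close>.\<close>

lemma sigma_projective_vimage_image:
  fixes f g :: "baire \<Rightarrow> baire"
  assumes f: "continuous_on UNIV f" and g: "continuous_on B g"
    and B: "sigma_projective (moves_II -` B)"
  shows "sigma_projective (f -` g ` B)"
proof -
  let ?E = "moves_II -` B"
  let ?D = "{w \<in> ?E. f (moves_I w) = g (moves_II w)}"
  \<comment> \<open>As \<open>g\<close> is continuous only on \<open>B\<close>, equality of the two
    values is a closed condition relative to \<open>?E\<close>; this suffices because
    \<open>?E\<close> is \<sigma>-projective.\<close>
  have "closedin (top_of_set ?E) (?E \<inter> (\<lambda>w. (f (moves_I w), g (moves_II w))) -` {p. fst p = snd p})"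
  proof (rule continuous_closedin_preimage)
    have "continuous_on ?E (\<lambda>w. f (moves_I w))"
      by (rule continuous_on_compose2[OF f]) (auto intro!: continuous_intros)
    moreover have "continuous_on ?E (\<lambda>w. g (moves_II w))"
      by (rule continuous_on_compose2[OF g]) (auto intro!: continuous_intros)
    ultimately show "continuous_on ?E (\<lambda>w. (f (moves_I w), g (moves_II w)))"
      by (rule continuous_on_Pair)
    have "closed {p :: baire \<times> baire. fst p i = snd p i}" for i
      by (rule closed_Collect_eq
            [OF continuous_on_product_then_coordinatewise[OF continuous_on_fst[OF continuous_on_id]]
              continuous_on_product_then_coordinatewise[OF continuous_on_snd[OF continuous_on_id]]])
    then have "closed (\<Inter>i. {p :: baire \<times> baire. fst p i = snd p i})"
      by blast
    also have "(\<Inter>i. {p :: baire \<times> baire. fst p i = snd p i}) = {p. fst p = snd p}"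
      by (auto simp: fun_eq_iff)
    finally show "closed {p :: baire \<times> baire. fst p = snd p}" .
  qed
  moreover have "?E \<inter> (\<lambda>w. (f (moves_I w), g (moves_II w))) -` {p. fst p = snd p} = ?D"
    by auto
  ultimately have "sigma_projective ?D"
    using sigma_projective_closedin[OF B] by simp
  then have "sigma_projective (moves_I ` ?D)"
    by (rule sigma_projective_image) (intro continuous_intros)
  moreover have "moves_I ` ?D = f -` g ` B"
  proof (intro equalityI subsetI)
    fix x assume "x \<in> f -` g ` B"
    then obtain y where y: "y \<in> B" "f x = g y"
      by auto
    then have "interleave x y \<in> ?D"
      by simp
    then show "x \<in> moves_I ` ?D"
      by (rule image_eqI[rotated]) simp
  qed auto
  ultimately show ?thesis
    by simp
qed

text \<open>Induction along the hierarchy, for all \<open>f\<close> at once: in the successor step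
  the hypothesis is applied to \<open>moves_II\<close>, so that the pairs with second member in
  \<open>B\<close> form a \<sigma>-projective set.\<close>

lemma Sigma1_vimage:
  assumes "Sigma1 \<xi> A" "continuous_on UNIV f"
  shows "sigma_projective (f -` A)"
  using assms
proof (induction arbitrary: f rule: Sigma1.induct)
  case (first \<xi> A)
  show ?case
  proof (cases "A = {}")
    case True
    then show ?thesis
      by (simp add: sigma_projective_open)
  next
    case False
    then obtain g :: "baire \<Rightarrow> baire" where "continuous_on UNIV g" "A = range g"
      using first.hyps by (auto simp: analytic_set_def)
    then show ?thesis
      using sigma_projective_vimage_image[OF first.prems, of UNIV g]
      by (simp add: sigma_projective_open)
  qed
next
  case (succ \<eta> \<xi> B g)
  have "continuous_on UNIV moves_II"
    by (intro continuous_on_moves_II continuous_on_id)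
  then have "sigma_projective (moves_II -` B)"
    using sigma_projective_Compl[OF succ.IH[of moves_II]] by (simp add: vimage_Compl)
  then show ?case
    using sigma_projective_vimage_image succ by blast
next
  case (limit \<xi> A)
  then have "sigma_projective (f -` A n)" for n
    by blast
  then show ?case
    using sigma_projective_UN[of "\<lambda>n. f -` A n"] by (simp add: vimage_UN)
qed

lemma sigma_projective_vimage:
  assumes "sigma_projective A" "continuous_on UNIV f"
  shows "sigma_projective (f -` A)"
  using assms Sigma1_vimage unfolding sigma_projective_iff_Sigma1[of A] by blast

lemma sigma_projective_UN_countable:
  fixes A :: "'i::countable \<Rightarrow> baire set"
  assumes "\<And>i. sigma_projective (A i)"
  shows "sigma_projective (\<Union>i. A i)"
proof -
  have "sigma_projective (\<Union>n. A (from_nat n))"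
    by (rule sigma_projective_UN) (rule assms)
  also have "(\<Union>n. A (from_nat n)) = (\<Union>i. A i)"
    by (metis image_image surj_from_nat)
  finally show ?thesis .
qed

lemma continuous_on_moves: "continuous_on UNIV moves_I" "continuous_on UNIV moves_II"
  using continuous_on_moves_I[OF continuous_on_id] continuous_on_moves_II[OF continuous_on_id]
  by simp_all

section \<open>Strategies as continuous functions\<close>

fun play :: "(nat list \<Rightarrow> nat) \<Rightarrow> baire" where
  "play c n = c (map (\<lambda>i. play c i) [0..<n])"

declare play.simps [simp del]

text \<open>With \<open>e = True\<close> the strategy \<open>s\<close> makes the even moves, as one
  of player I does, and with \<open>e = False\<close> the odd ones. The opponent plays
  \<open>x\<close>; in both cases the opponent's move at position \<open>i\<close> has index
  \<open>i div 2\<close>.\<close>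

definition follow :: "bool \<Rightarrow> (nat list \<Rightarrow> nat) \<Rightarrow> baire \<Rightarrow> baire" where
  "follow e s x = play (\<lambda>l. if even (length l) = e then s l else x (length l div 2))"

lemma follow_eq:
  "follow e s x n = (if even n = e then s (map (follow e s x) [0..<n]) else x (n div 2))"
  unfolding follow_def by (subst play.simps) simp

lemma follow_cong:
  assumes "\<And>i. i \<le> n \<Longrightarrow> x i = y i"
  shows "follow e s x n = follow e s y n"
  using assms
proof (induction n rule: less_induct)
  case (less n)
  have "follow e s x i = follow e s y i" if "i < n" for i
    using less that by auto
  then have m: "map (follow e s x) [0..<n] = map (follow e s y) [0..<n]"
    by simp
  show ?case
    unfolding follow_eq[of e s x n] follow_eq[of e s y n] m using less.prems[of "n div 2"] by simp
qed

text \<open>A coordinate of the play depends only on finitely many moves of the opponent, hence is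
  locally constant.\<close>

lemma continuous_on_follow: "continuous_on UNIV (follow e s)"
proof (rule continuous_on_coordinatewise_then_product)
  fix n
  have "open ((\<lambda>x. follow e s x n) -` B)" for B
  proof (subst open_subopen, intro ballI)
    fix x assume x: "x \<in> (\<lambda>x. follow e s x n) -` B"
    let ?T = "cylinder (map x [0..<Suc n])"
    have "follow e s y n = follow e s x n" if "y \<in> ?T" for y
    proof (rule follow_cong)
      fix i assume "i \<le> n"
      then show "y i = x i"
        using that by (simp add: cylinder_iff del: upt_Suc)
    qed
    then have "?T \<subseteq> (\<lambda>x. follow e s x n) -` B"
      using x unfolding vimage_def by force
    moreover have "x \<in> ?T"
      by (simp add: cylinder_iff del: upt_Suc)
    ultimately show "\<exists>T. open T \<and> x \<in> T \<and> T \<subseteq> (\<lambda>x. follow e s x n) -` B"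
      using open_cylinder by blast
  qed
  then show "continuous_on UNIV (\<lambda>x. follow e s x n)"
    by (simp add: continuous_on_open_vimage)
qed

lemma winning_I_continuous:
  assumes "winning_I A s"
  shows "\<exists>g. continuous_on UNIV g \<and> (\<forall>z. \<exists>w\<in>A. moves_I w = g z \<and> moves_II w = z)"
proof (intro exI[of _ "\<lambda>z. moves_I (follow True s z)"] conjI allI bexI)
  fix z
  show "moves_II (follow True s z) = z"
    unfolding moves_II_def by (subst follow_eq) simp
  have "follow True s z (2 * n) = s (map (follow True s z) [0..<2 * n])" for n
    by (subst follow_eq) simp
  then show "follow True s z \<in> A"
    using assms unfolding winning_I_def by blast
qed (auto intro: continuous_on_moves_I continuous_on_follow)

lemma winning_II_continuous:
  assumes "winning_II A t"
  shows "\<exists>f. continuous_on UNIV f \<and> (\<forall>x. \<exists>w. w \<notin> A \<and> moves_I w = x \<and> moves_II w = f x)"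
proof (intro exI[of _ "\<lambda>x. moves_II (follow False t x)"] conjI allI)
  fix x
  have "moves_I (follow False t x) = x"
    unfolding moves_I_def by (subst follow_eq) simp
  moreover have "follow False t x (2 * n + 1) = t (map (follow False t x) [0..<2 * n + 1])" for n
    by (subst follow_eq) simp
  then have "follow False t x \<notin> A"
    using assms unfolding winning_II_def by blast
  ultimately show "\<exists>w. w \<notin> A \<and> moves_I w = x \<and> moves_II w = moves_II (follow False t x)"
    by blast
qed (auto intro: continuous_on_moves_II continuous_on_follow)


section \<open>Decomposition of a compact space into cells\<close>

text \<open>A compact copy of the Cantor space inside the Baire space; its members suffice as codes
  of cells.\<close>

definition bits :: "baire set" where
  "bits = {x. \<forall>i. x i \<le> 1}"

lemma compact_bits: "compact bits"
proof -
  have "compactin (product_topology (\<lambda>i::nat. euclidean :: nat topology) UNIV)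
      (\<Pi>\<^sub>E i\<in>UNIV. {..1::nat})"
    by (simp add: compactin_PiE compactin_euclidean_iff finite_imp_compact)
  moreover have "(\<Pi>\<^sub>E i\<in>UNIV. {..1::nat}) = bits"
    by (auto simp: bits_def PiE_iff)
  ultimately show ?thesis
    by (simp add: euclidean_product_topology compactin_euclidean_iff)
qed

locale closed_pairs =
  fixes Y :: "'c topology" and C :: "nat \<Rightarrow> bool \<Rightarrow> 'c set"
  assumes compact_Y: "compact_space Y"
    and closedin_C: "\<And>k b. closedin Y (C k b)"
    and cover_C: "\<And>k. C k False \<union> C k True = topspace Y"
begin

text \<open>All nonzero values are read alike, so that every sequence of naturals that player II may
  produce is the code of a cell. Different cells may overlap, as the sets of a pair may.\<close>

definition cell :: "baire \<Rightarrow> 'c set" where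
  "cell z = (\<Inter>k. C k (z k \<noteq> 0))"

text \<open>The approximation to a cell given by an initial segment of its code; the factor
  \<open>topspace Y\<close> serves the empty list.\<close>

definition fcell :: "nat list \<Rightarrow> 'c set" where
  "fcell l = topspace Y \<inter> (\<Inter>k<length l. C k (l ! k \<noteq> 0))"

lemma C_subset: "C k b \<subseteq> topspace Y"
  using closedin_C closedin_subset by blast

lemma cell_subset: "cell z \<subseteq> topspace Y"
  unfolding cell_def using C_subset by blast

lemma closedin_fcell: "closedin Y (fcell l)"
proof -
  have "closedin Y (\<Inter>(insert (topspace Y) ((\<lambda>k. C k (l ! k \<noteq> 0)) ` {..<length l})))"
    using closedin_C by (intro closedin_Inter) auto
  then show ?thesis
    by (simp add: fcell_def)
qed

lemma ex_cell:
  assumes "y \<in> topspace Y"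
  shows "\<exists>z\<in>bits. y \<in> cell z"
proof
  let ?z = "\<lambda>k. if y \<in> C k True then 1 else 0 :: nat"
  show "?z \<in> bits"
    by (simp add: bits_def)
  have "y \<in> C k (?z k \<noteq> 0)" for k
    using assms cover_C[of k] by auto
  then show "y \<in> cell ?z"
    unfolding cell_def by blast
qed

text \<open>The pairs \<open>(x, y)\<close> with \<open>y \<in> cell (f x)\<close> form a closed
  set, and projecting along a compact factor is a closed map.\<close>

lemma closedin_UN_cell:
  assumes "compact S" "continuous_on S f"
  shows "closedin Y (\<Union>x\<in>S. cell (f x))"
proof -
  let ?P = "prod_topology (top_of_set S) Y"
  \<comment> \<open>\<open>D k\<close> is the \<open>k\<close>-th condition on a pair, split by
    whether \<open>f x k\<close> is zero. Both parts are products of closed sets, since all sets of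
    naturals are closed in the discrete topology.\<close>
  define D where "D k = (S \<inter> (\<lambda>x. f x k) -` (- {0})) \<times> C k True \<union> (S \<inter> (\<lambda>x. f x k) -` {0}) \<times> C k False" for k
  have S: "closedin (top_of_set S) (S \<inter> (\<lambda>x. f x k) -` V)" for k and V :: "nat set"
    using continuous_on_product_then_coordinatewise[OF assms(2)]
    by (rule continuous_closedin_preimage) (simp add: closed_def open_discrete)
  have "closedin ?P (D k)" for k
    unfolding D_def by (intro closedin_Un) (simp_all only: closedin_prod_Times_iff S closedin_C simp_thms)
  then have "closedin ?P (\<Inter>k. D k)"
    by (intro closedin_Inter) auto
  moreover have "closed_map ?P Y snd"
    using assms(1) by (intro closed_map_snd) (simp add: compact_space_subtopology compactin_euclidean_iff)
  ultimately have "closedin Y (snd ` (\<Inter>k. D k))"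
    by (simp add: closed_map_def)
  moreover have "snd ` (\<Inter>k. D k) = (\<Union>x\<in>S. cell (f x))"
  proof (intro equalityI subsetI)
    fix y assume "y \<in> snd ` (\<Inter>k. D k)"
    then obtain x where "(x, y) \<in> (\<Inter>k. D k)"
      by force
    then have D: "(x, y) \<in> D k" for k
      by blast
    have "y \<in> C k (f x k \<noteq> 0)" for k
      using D[of k] by (auto simp: D_def)
    moreover have "x \<in> S"
      using D[of 0] by (auto simp: D_def)
    ultimately show "y \<in> (\<Union>x\<in>S. cell (f x))"
      unfolding cell_def by blast
  next
    fix y assume "y \<in> (\<Union>x\<in>S. cell (f x))"
    then obtain x where x: "x \<in> S" "y \<in> cell (f x)"
      by blast
    have "(x, y) \<in> D k" for k
    proof -
      have "y \<in> C k (f x k \<noteq> 0)"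
        using x(2) unfolding cell_def by blast
      then show ?thesis
        using x(1) by (cases "f x k = 0") (auto simp: D_def)
    qed
    then have "(x, y) \<in> (\<Inter>k. D k)"
      by blast
    then show "y \<in> snd ` (\<Inter>k. D k)"
      by (rule image_eqI[rotated]) simp
  qed
  ultimately show ?thesis
    by simp
qed

text \<open>Finitely many of the closed sets whose intersection is the cell all contain one
  approximation, so the finite intersection property applies to \<open>K\<close>.\<close>

lemma compactin_meets_cell_iff:
  assumes "compactin Y K"
  shows "K \<inter> cell z \<noteq> {} \<longleftrightarrow> (\<forall>n. K \<inter> fcell (map z [0..<n]) \<noteq> {})"
proof
  assume "K \<inter> cell z \<noteq> {}"
  then show "\<forall>n. K \<inter> fcell (map z [0..<n]) \<noteq> {}"
    using cell_subset[of z] by (fastforce simp: fcell_def cell_def)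
next
  assume R: "\<forall>n. K \<inter> fcell (map z [0..<n]) \<noteq> {}"
  let ?U = "range (\<lambda>k. C k (z k \<noteq> 0))"
  have "K \<inter> \<Inter>\<F> \<noteq> {}" if fin: "finite \<F>" and sub: "\<F> \<subseteq> ?U" for \<F>
  proof -
    obtain J where J: "finite J" "\<F> = (\<lambda>k. C k (z k \<noteq> 0)) ` J"
      using finite_subset_image[OF fin sub] by auto
    obtain n where n: "\<And>k. k \<in> J \<Longrightarrow> k < n"
      using J(1) finite_nat_set_iff_bounded by auto
    obtain y where "y \<in> K" "y \<in> fcell (map z [0..<n])"
      using R by blast
    then have "y \<in> K \<inter> \<Inter>\<F>"
      using n J(2) by (auto simp: fcell_def)
    then show ?thesis
      by blast
  qed
  moreover have "\<forall>D\<in>?U. closedin Y D"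
    using closedin_C by blast
  ultimately have "K \<inter> \<Inter>?U \<noteq> {}"
    using assms unfolding compactin_fip by blast
  then show "K \<inter> cell z \<noteq> {}"
    by (simp add: cell_def)
qed

text \<open>\<open>cell z\<close> meets \<open>R\<close> iff it meets some \<open>F a\<close>. As
  \<open>F a\<close> is compact, this holds iff \<open>F a\<close> meets all approximations of the
  cell: countably many conditions on \<open>(a, z)\<close>, each relatively closed in
  \<open>a\<close> for a given initial segment of \<open>z\<close>. Projecting to \<open>z\<close>
  gives the set.\<close>

lemma sigma_projective_cells_meeting:
  assumes R: "R \<subseteq> topspace Y" and K: "class_K (subtopology Y R)"
  shows "sigma_projective {z. cell z \<inter> R \<noteq> {}}"
proof -
  obtain A F where A: "sigma_projective A" and F: "USCCV (top_of_set A) (subtopology Y R) F"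
    and onto: "(\<Union>x\<in>A. F x) = topspace (subtopology Y R)"
    using K unfolding class_K_def by blast
  have onto': "(\<Union>x\<in>A. F x) = R"
    using onto R by auto
  have cF: "compactin Y (F a)" "F a \<subseteq> R" if "a \<in> A" for a
    using F that by (auto simp: USCCV_def compactin_subtopology)
  define D where "D l = {a \<in> A. F a \<inter> fcell l \<noteq> {}}" for l
  have D: "sigma_projective (D l)" for l
  proof -
    \<comment> \<open>Upper semicontinuity of \<open>F\<close> is relative to \<open>R\<close>, so
      the approximations are cut down to \<open>R\<close>, which contains all values of
      \<open>F\<close>.\<close>
    have "closedin (subtopology Y R) (R \<inter> fcell l)"
      using closedin_fcell by (auto simp: closedin_subtopology)
    then have "closedin (top_of_set A) {a \<in> A. F a \<inter> (R \<inter> fcell l) \<noteq> {}}"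
      using F unfolding USCCV_def by simp
    moreover have "{a \<in> A. F a \<inter> (R \<inter> fcell l) \<noteq> {}} = D l"
      unfolding D_def using cF(2) by blast
    ultimately show ?thesis
      using sigma_projective_closedin[OF A] by simp
  qed
  let ?G = "\<lambda>n l. if length l = n then moves_I -` D l \<inter> moves_II -` cylinder l else {}"
  have "sigma_projective (?G n l)" for n l
    using D by (simp add: sigma_projective_Int sigma_projective_vimage sigma_projective_cylinder
        continuous_on_moves sigma_projective_open)
  then have G: "sigma_projective (\<Inter>n. \<Union>l. ?G n l)"
    by (intro sigma_projective_INT sigma_projective_UN_countable)
  have "(\<Inter>n. \<Union>l. ?G n l) = {w. \<forall>n. moves_I w \<in> D (map (moves_II w) [0..<n])}"
  proof (intro equalityI subsetI)
    fix w assume w: "w \<in> (\<Inter>n. \<Union>l. ?G n l)"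
    have "moves_I w \<in> D (map (moves_II w) [0..<n])" for n
    proof -
      obtain l where "w \<in> ?G n l"
        using w by blast
      then have "length l = n" "moves_I w \<in> D l" "moves_II w \<in> cylinder l"
        by (auto split: if_splits)
      then show ?thesis
        by (simp add: cylinder_def)
    qed
    then show "w \<in> {w. \<forall>n. moves_I w \<in> D (map (moves_II w) [0..<n])}"
      by blast
  next
    fix w assume w: "w \<in> {w. \<forall>n. moves_I w \<in> D (map (moves_II w) [0..<n])}"
    have "w \<in> ?G n (map (moves_II w) [0..<n])" for n
      using w by (simp add: cylinder_def)
    then show "w \<in> (\<Inter>n. \<Union>l. ?G n l)"
      by blast
  qed
  also have "\<dots> = {w. moves_I w \<in> A \<and> F (moves_I w) \<inter> cell (moves_II w) \<noteq> {}}"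
    unfolding D_def using compactin_meets_cell_iff[OF cF(1)] by blast
  finally have "sigma_projective {w. moves_I w \<in> A \<and> F (moves_I w) \<inter> cell (moves_II w) \<noteq> {}}"
    (is "sigma_projective ?H")
    using G by simp
  then have "sigma_projective (moves_II ` ?H)"
    using continuous_on_moves(2) by (intro sigma_projective_image) (auto intro: continuous_on_subset)
  also have "moves_II ` ?H = {z. cell z \<inter> R \<noteq> {}}"
  proof (intro equalityI subsetI)
    fix z assume "z \<in> {z. cell z \<inter> R \<noteq> {}}"
    then obtain a where "a \<in> A" "F a \<inter> cell z \<noteq> {}"
      using onto' by blast
    then have "interleave a z \<in> ?H"
      by simp
    then show "z \<in> moves_II ` ?H"
      by (rule image_eqI[rotated]) simp
  qed (use cF(2) in blast)
  finally show ?thesis .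
qed

text \<open>The constant multifunction with value \<open>topspace Y\<close> puts the compact space
  \<open>Y\<close> into the class, so the preceding lemma applies to
  \<open>R = topspace Y\<close>.\<close>

lemma sigma_projective_nonempty_cells: "sigma_projective {z. cell z \<noteq> {}}"
proof -
  have "USCCV (top_of_set UNIV) Y (\<lambda>_::baire. topspace Y)"
    using compact_Y by (simp add: USCCV_def compact_space_def)
  then have "class_K Y"
    unfolding class_K_def
    by (intro exI[of _ UNIV] exI[of _ "\<lambda>_. topspace Y"]) (simp add: sigma_projective_open)
  then have "sigma_projective {z. cell z \<inter> topspace Y \<noteq> {}}"
    by (intro sigma_projective_cells_meeting) auto
  then show ?thesis
    using cell_subset by (simp add: Int_absorb2)
qed

end

section \<open>The game\<close>

text \<open>Within \<open>bits\<close> this is a countable dense set; its complement there is a copy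
  of the irrationals, the standard space that is not Menger.\<close>

definition eventually_zero :: "baire set" where
  "eventually_zero = {x. \<exists>n. \<forall>i\<ge>n. x i = 0}"

lemma closed_vimage_coordinate:
  fixes f :: "baire \<Rightarrow> baire"
  assumes "continuous_on UNIV f"
  shows "closed {x. f x i \<in> V}"
proof -
  have "closed ((\<lambda>x. f x i) -` V)"
    using continuous_on_product_then_coordinatewise[OF assms]
    by (intro closed_vimage) (simp_all add: closed_def open_discrete)
  then show ?thesis
    by (simp add: vimage_def)
qed

lemma closed_zero_from:
  fixes f :: "baire \<Rightarrow> baire"
  assumes "continuous_on UNIV f"
  shows "closed {x. \<forall>i\<ge>n. f x i = 0}"
proof -
  have "closed (\<Inter>i\<in>{n..}. {x. f x i \<in> {0}})"
    using closed_vimage_coordinate[OF assms] by (intro closed_INT ballI)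
  also have "(\<Inter>i\<in>{n..}. {x. f x i \<in> {0}}) = {x. \<forall>i\<ge>n. f x i = 0}"
    by auto
  finally show ?thesis .
qed

lemma sigma_projective_eventually_zero: "sigma_projective eventually_zero"
proof -
  have "sigma_projective {x. \<forall>i\<ge>n. x i = 0}" for n
    using closed_zero_from[OF continuous_on_id] by (rule sigma_projective_closed)
  then have "sigma_projective (\<Union>n. {x. \<forall>i\<ge>n. x i = 0})"
    by (rule sigma_projective_UN)
  also have "(\<Union>n. {x :: baire. \<forall>i\<ge>n. x i = 0}) = eventually_zero"
    by (auto simp: eventually_zero_def)
  finally show ?thesis .
qed

lemma bounded_sums_eventually_zero:
  fixes x :: baire
  assumes "\<And>k. (\<Sum>i<k. x i) \<le> n"
  shows "x \<in> eventually_zero"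
proof (rule ccontr)
  assume "x \<notin> eventually_zero"
  then have inf: "\<exists>i\<ge>m. x i \<noteq> 0" for m
    by (auto simp: eventually_zero_def)
  have "\<exists>k. j \<le> (\<Sum>i<k. x i)" for j
  proof (induction j)
    case (Suc j)
    then obtain k where k: "j \<le> (\<Sum>i<k. x i)"
      by blast
    obtain m where m: "m \<ge> k" "x m \<noteq> 0"
      using inf by blast
    have "(\<Sum>i<k. x i) \<le> (\<Sum>i<m. x i)"
      using m(1) by (intro sum_mono2) auto
    then have "Suc j \<le> (\<Sum>i<Suc m. x i)"
      using k m(2) by simp
    then show ?case
      by blast
  qed simp
  then obtain k where "Suc n \<le> (\<Sum>i<k. x i)"
    by blast
  then show False
    using assms[of k] by simp
qed

text \<open>A diagonal choice: the ones are placed at increasing positions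
  \<open>q n \<ge> k n\<close>, so that only the first \<open>n\<close> of them can lie below
  \<open>k n\<close>.\<close>

lemma ex_sparse_bits:
  fixes k :: "nat \<Rightarrow> nat"
  shows "\<exists>x\<in>bits. x \<notin> eventually_zero \<and> (\<forall>n. (\<Sum>i<k n. x i) \<le> n)"
proof -
  \<comment> \<open>The summand \<open>n\<close> makes \<open>q\<close> strictly increasing, the sum
    makes it dominate \<open>k\<close>.\<close>
  define q where "q n = n + (\<Sum>i\<le>n. k i)" for n
  have "strict_mono q"
    unfolding strict_mono_Suc_iff by (simp add: q_def)
  have kq: "k n \<le> q n" for n
    using member_le_sum[of n "{..n}" k] by (simp add: q_def)
  define x where "x i = (if i \<in> range q then 1 else 0 :: nat)" for i
  have "x \<in> bits"
    by (simp add: bits_def x_def)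
  moreover have "x \<notin> eventually_zero"
  proof
    assume "x \<in> eventually_zero"
    then obtain n where n: "\<And>i. i \<ge> n \<Longrightarrow> x i = 0"
      by (auto simp: eventually_zero_def)
    have "n \<le> q n"
      by (simp add: q_def)
    then have "x (q n) = 0"
      by (rule n)
    then show False
      by (simp add: x_def)
  qed
  moreover have "(\<Sum>i<k n. x i) \<le> n" for n
  proof -
    have "{..<k n} \<inter> range q \<subseteq> q ` {..<n}"
    proof
      fix i assume "i \<in> {..<k n} \<inter> range q"
      then obtain j where j: "i = q j" "q j < k n"
        by auto
      then have "q j < q n"
        using kq[of n] by linarith
      then have "j < n"
        using \<open>strict_mono q\<close> strict_mono_less by blast
      then show "i \<in> q ` {..<n}"
        using j(1) by blast
    qed
    then have "card ({..<k n} \<inter> range q) \<le> card (q ` {..<n})"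
      by (intro card_mono) auto
    also have "\<dots> \<le> n"
      using card_image_le[of "{..<n}" q] by simp
    also have "card ({..<k n} \<inter> range q) = (\<Sum>i<k n. x i)"
      unfolding x_def by (simp add: sum.If_cases)
    finally show ?thesis .
  qed
  ultimately show ?thesis
    by blast
qed

section \<open>Consequences of a winning strategy for either player\<close>

context closed_pairs
begin

text \<open>Every point of \<open>X\<close> lies in the cell of some \<open>z\<close> in
  \<open>bits\<close>, and \<open>g z\<close> vanishes from some \<open>n\<close> on. For fixed
  \<open>n\<close> these \<open>z\<close> form a compact set, so the union of their cells is closed
  in \<open>Y\<close>; it is contained in \<open>X\<close>.\<close>

lemma sigma_compact_from_player_I:
  assumes X: "X \<subseteq> topspace Y" and g: "continuous_on UNIV g"
    and zero: "\<And>z. cell z \<inter> X \<noteq> {} \<Longrightarrow> g z \<in> eventually_zero"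
    and sub: "\<And>z. g z \<in> eventually_zero \<Longrightarrow> cell z \<subseteq> X"
  shows "sigma_compact_space (subtopology Y X)"
proof -
  define N where "N n = bits \<inter> {z. \<forall>i\<ge>n. g z i = 0}" for n :: nat
  define K where "K n = (\<Union>z\<in>N n. cell z)" for n
  have "compactin (subtopology Y X) (K n)" for n
  proof -
    have "compact (N n)"
      unfolding N_def using compact_bits closed_zero_from[OF g] by (rule compact_Int_closed)
    then have "closedin Y (K n)"
      unfolding K_def using closedin_UN_cell[of "N n" "\<lambda>z. z"] by simp
    then have "compactin Y (K n)"
      using compact_Y closedin_compact_space by blast
    moreover have "K n \<subseteq> X"
      unfolding K_def using sub by (force simp: N_def eventually_zero_def)
    ultimately show ?thesis
      by (simp add: compactin_subtopology)
  qed
  moreover have "(\<Union>n. K n) = topspace (subtopology Y X)"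
  proof
    show "(\<Union>n. K n) \<subseteq> topspace (subtopology Y X)"
      using calculation compactin_subset_topspace by blast
    show "topspace (subtopology Y X) \<subseteq> (\<Union>n. K n)"
    proof
      fix y assume "y \<in> topspace (subtopology Y X)"
      then have y: "y \<in> topspace Y" "y \<in> X"
        by auto
      obtain z where z: "z \<in> bits" "y \<in> cell z"
        using ex_cell[OF y(1)] by blast
      then have "g z \<in> eventually_zero"
        using y(2) zero by blast
      then obtain n where "z \<in> N n"
        using z(1) by (auto simp: N_def eventually_zero_def)
      then show "y \<in> (\<Union>n. K n)"
        using z(2) unfolding K_def by blast
    qed
  qed
  ultimately show ?thesis
    unfolding sigma_compact_space_def by blast
qed

text \<open>Since \<open>x\<close> with boundedly many ones is eventually zero, compactness makes the sets \<open>W n k\<close>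
  (for fixed \<open>n\<close>) an increasing open cover of \<open>X\<close>; a sequence whose ones are sparse enough escapes
  every choice of one \<open>W n (k n)\<close> for each \<open>n\<close>.\<close>

lemma not_Menger_from_player_II:
  assumes X: "X \<subseteq> topspace Y" and f: "continuous_on UNIV f"
    and zero: "\<And>x. x \<in> eventually_zero \<Longrightarrow> cell (f x) \<inter> X = {}"
    and nonzero: "\<And>x. x \<notin> eventually_zero \<Longrightarrow> cell (f x) \<inter> X \<noteq> {}"
  shows "\<not> Menger_space (subtopology Y X)"
proof
  assume Menger: "Menger_space (subtopology Y X)"
  define S where "S n k = {x :: baire. (\<Sum>i<k. x i) \<le> n}" for n k :: nat
  define W where "W n k = X - (\<Union>x\<in>bits \<inter> S n k. cell (f x))" for n k
  have closed_S: "closed (S n k)" for n k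
  proof -
    have "continuous_on UNIV (\<lambda>x :: baire. x i)" for i
      by simp
    then have "continuous_on UNIV (\<lambda>x :: baire. \<Sum>i<k. x i)"
      by (rule continuous_on_sum)
    then show ?thesis
      unfolding S_def by (intro closed_Collect_le continuous_on_const)
  qed
  have S_anti: "S n k' \<subseteq> S n k" if "k \<le> k'" for n k k'
  proof
    fix x assume "x \<in> S n k'"
    moreover have "(\<Sum>i<k. x i) \<le> (\<Sum>i<k'. x i)"
      using that by (intro sum_mono2) auto
    ultimately show "x \<in> S n k"
      by (simp add: S_def)
  qed
  then have W_mono: "W n k \<subseteq> W n k'" if "k \<le> k'" for n k k'
    using that unfolding W_def by blast
  have openin_W: "openin (subtopology Y X) (W n k)" for n k
  proof -
    have "compact (bits \<inter> S n k)"
      using compact_bits closed_S by (rule compact_Int_closed)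
    then have "closedin Y (\<Union>x\<in>bits \<inter> S n k. cell (f x))"
      using f continuous_on_subset by (intro closedin_UN_cell) blast+
    then have "openin Y (topspace Y - (\<Union>x\<in>bits \<inter> S n k. cell (f x)))"
      by blast
    moreover have "W n k = (topspace Y - (\<Union>x\<in>bits \<inter> S n k. cell (f x))) \<inter> X"
      using X unfolding W_def by blast
    ultimately show ?thesis
      unfolding openin_subtopology by blast
  qed
  have cover_W: "\<exists>k. y \<in> W n k" if y: "y \<in> X" for y n
  proof (rule ccontr)
    assume "\<nexists>k. y \<in> W n k"
    then have none: "\<exists>x\<in>bits \<inter> S n k. y \<in> cell (f x)" for k
      using y unfolding W_def by blast
    have "closed (\<Inter>j. {x. f x j \<in> {m. y \<in> C j (m \<noteq> 0)}})"
      using closed_vimage_coordinate[OF f] by (intro closed_INT ballI)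
    also have "(\<Inter>j. {x. f x j \<in> {m. y \<in> C j (m \<noteq> 0)}}) = {x. y \<in> cell (f x)}"
      by (auto simp: cell_def)
    finally have cl: "closed {x. y \<in> cell (f x)}" .
    \<comment> \<open>The witnesses obtained so far depend on \<open>k\<close>; by compactness of
      \<open>bits\<close> a single \<open>x\<close> serves all \<open>k\<close>, and its partial
      sums are all at most \<open>n\<close>.\<close>
    have "bits \<inter> (\<Inter>k\<in>UNIV. S n k \<inter> {x. y \<in> cell (f x)}) \<noteq> {}"
    proof (rule compact_imp_fip_image[OF compact_bits])
      show "closed (S n k \<inter> {x. y \<in> cell (f x)})" for k
        using closed_S cl by (rule closed_Int)
      fix I :: "nat set" assume "finite I"
      then obtain k where k: "\<And>i. i \<in> I \<Longrightarrow> i \<le> k"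
        using finite_nat_set_iff_bounded_le by auto
      obtain x where "x \<in> bits" "x \<in> S n k" "y \<in> cell (f x)"
        using none by blast
      then have "x \<in> bits \<inter> (\<Inter>i\<in>I. S n i \<inter> {x. y \<in> cell (f x)})"
        using k S_anti by blast
      then show "bits \<inter> (\<Inter>i\<in>I. S n i \<inter> {x. y \<in> cell (f x)}) \<noteq> {}"
        by blast
    qed
    then obtain x where x: "\<And>k. x \<in> S n k" "y \<in> cell (f x)"
      by blast
    then have "x \<in> eventually_zero"
      using bounded_sums_eventually_zero[of x n] by (simp add: S_def)
    then show False
      using zero x(2) y by blast
  qed
  have union_W: "\<Union>(range (W n)) = topspace (subtopology Y X)" for n
  proof
    show "\<Union>(range (W n)) \<subseteq> topspace (subtopology Y X)"
      using openin_W openin_subset by blast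
    show "topspace (subtopology Y X) \<subseteq> \<Union>(range (W n))"
      using cover_W[of _ n] by auto
  qed
  have "\<exists>V. (\<forall>n. finite (V n) \<and> V n \<subseteq> range (W n)) \<and> \<Union>(\<Union>n. V n) = topspace (subtopology Y X)"
    by (rule Menger[unfolded Menger_space_def, rule_format]) (use union_W openin_W in auto)
  then obtain V where V: "\<And>n. finite (V n)" "\<And>n. V n \<subseteq> range (W n)"
      "\<Union>(\<Union>n. V n) = topspace (subtopology Y X)"
    by auto
  have "\<exists>k. \<Union>(V n) \<subseteq> W n k" for n
  proof -
    obtain J where J: "finite J" "V n = W n ` J"
      using finite_subset_image[OF V(1) V(2)] by blast
    obtain k where k: "\<And>j. j \<in> J \<Longrightarrow> j \<le> k"
      using J(1) finite_nat_set_iff_bounded_le by auto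
    have "W n j \<subseteq> W n k" if "j \<in> J" for j
      using W_mono[OF k[OF that]] .
    then have "\<Union>(V n) \<subseteq> W n k"
      unfolding J(2) by (rule UN_least)
    then show ?thesis
      by blast
  qed
  then obtain k where k: "\<And>n. \<Union>(V n) \<subseteq> W n (k n)"
    by metis
  obtain x where x: "x \<in> bits" "x \<notin> eventually_zero" "\<And>n. (\<Sum>i<k n. x i) \<le> n"
    using ex_sparse_bits[of k] by blast
  obtain y where y: "y \<in> cell (f x)" "y \<in> X"
    using nonzero[OF x(2)] by blast
  then have "y \<in> \<Union>(\<Union>n. V n)"
    using V(3) X by auto
  then obtain n where "y \<in> W n (k n)"
    using k by blast
  moreover have "x \<in> S n (k n)"
    using x(3) by (simp add: S_def)
  ultimately show False
    using y(1) x(1) unfolding W_def by blast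
qed

theorem Menger_imp_sigma_compact:
  assumes det: "sigma_projective_determinacy" and X: "X \<subseteq> topspace Y"
    and sep: "\<And>z. cell z \<subseteq> X \<or> cell z \<inter> X = {}"
    and Menger: "Menger_space (subtopology Y X)"
    and K: "class_K (subtopology Y (topspace Y - X))"
  shows "sigma_compact_space (subtopology Y X)"
proof -
  define ZR where "ZR = {z. cell z \<inter> (topspace Y - X) \<noteq> {}}"
  define ZX where "ZX = {z. cell z \<inter> X \<noteq> {}}"
  have ZR: "sigma_projective ZR"
    unfolding ZR_def using K by (intro sigma_projective_cells_meeting) auto
  \<comment> \<open>By \<open>sep\<close>, a nonempty cell meets \<open>X\<close> iff it misses the
    remainder, so the complexity of \<open>ZX\<close> is controlled by that of
    \<open>ZR\<close>.\<close>
  have "ZX = {z. cell z \<noteq> {}} \<inter> - ZR"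
    unfolding ZX_def ZR_def using sep cell_subset by blast
  then have ZX: "sigma_projective ZX"
    using sigma_projective_Int[OF sigma_projective_nonempty_cells sigma_projective_Compl[OF ZR]]
    by simp
  \<comment> \<open>\<open>P\<close> is the payoff of player I, hence the complement of the two
    implications, written as disjunctions, that II has to satisfy. A code of an empty cell loses for
    II.\<close>
  define P where "P = - ((- (moves_I -` eventually_zero) \<union> moves_II -` ZR) \<inter>
    (moves_I -` eventually_zero \<union> moves_II -` ZX))"
  have "sigma_projective P"
    unfolding P_def using ZR ZX
    by (intro sigma_projective_Compl sigma_projective_Int sigma_projective_Un sigma_projective_vimage
        continuous_on_moves sigma_projective_eventually_zero)
  then have "determined P"
    using det by (simp add: sigma_projective_determinacy_def)
  then consider s where "winning_I P s" | t where "winning_II P t"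
    unfolding determined_def by blast
  then show ?thesis
  proof cases
    case 1
    obtain g where g: "continuous_on UNIV g" "\<And>z. \<exists>w\<in>P. moves_I w = g z \<and> moves_II w = z"
      using winning_I_continuous[OF 1] by blast
    have win: "g z \<in> eventually_zero \<and> z \<notin> ZR \<or> g z \<notin> eventually_zero \<and> z \<notin> ZX" for z
      using g(2)[of z] unfolding P_def by auto
    show ?thesis
    proof (rule sigma_compact_from_player_I[OF X g(1)])
      show "g z \<in> eventually_zero" if "cell z \<inter> X \<noteq> {}" for z
        using that win[of z] by (auto simp: ZX_def)
      show "cell z \<subseteq> X" if "g z \<in> eventually_zero" for z
        using that win[of z] cell_subset[of z] by (auto simp: ZR_def)
    qed
  next
    case 2
    obtain f where f: "continuous_on UNIV f" "\<And>x. \<exists>w. w \<notin> P \<and> moves_I w = x \<and> moves_II w = f x"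
      using winning_II_continuous[OF 2] by blast
    have win: "(x \<in> eventually_zero \<longrightarrow> f x \<in> ZR) \<and> (x \<notin> eventually_zero \<longrightarrow> f x \<in> ZX)" for x
      using f(2)[of x] unfolding P_def by auto
    have "\<not> Menger_space (subtopology Y X)"
    proof (rule not_Menger_from_player_II[OF X f(1)])
      show "cell (f x) \<inter> X = {}" if "x \<in> eventually_zero" for x
        using that win[of x] sep[of "f x"] by (auto simp: ZR_def)
      show "cell (f x) \<inter> X \<noteq> {}" if "x \<notin> eventually_zero" for x
        using that win[of x] by (auto simp: ZX_def)
    qed
    then show ?thesis
      using Menger by contradiction
  qed
qed

end

section \<open>Separating a perfect preimage from its remainder\<close>

lemma Menger_space_continuous_image:
  assumes Menger: "Menger_space X" and h: "continuous_map X Z h" and onto: "h ` topspace X = topspace Z"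
  shows "Menger_space Z"
  unfolding Menger_space_def
proof (intro allI impI)
  fix \<U> :: "nat \<Rightarrow> 'b set set"
  assume U: "\<forall>n. (\<forall>U \<in> \<U> n. openin Z U) \<and> \<Union>(\<U> n) = topspace Z"
  define pre where "pre U = {x \<in> topspace X. h x \<in> U}" for U
  have "\<exists>\<V>. (\<forall>n. finite (\<V> n) \<and> \<V> n \<subseteq> pre ` \<U> n) \<and> \<Union>(\<Union>n. \<V> n) = topspace X"
  proof (rule Menger[unfolded Menger_space_def, rule_format])
    fix n
    have "openin X U" if "U \<in> pre ` \<U> n" for U
      using that U h openin_continuous_map_preimage unfolding pre_def by blast
    moreover have "\<Union>(pre ` \<U> n) = topspace X"
    proof
      show "topspace X \<subseteq> \<Union>(pre ` \<U> n)"
      proof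
        fix x assume x: "x \<in> topspace X"
        then have "h x \<in> \<Union>(\<U> n)"
          using U onto by auto
        then show "x \<in> \<Union>(pre ` \<U> n)"
          using x unfolding pre_def by blast
      qed
    qed (auto simp: pre_def)
    ultimately show "(\<forall>U\<in>pre ` \<U> n. openin X U) \<and> \<Union>(pre ` \<U> n) = topspace X"
      by blast
  qed
  then obtain \<V> where V: "\<And>n. finite (\<V> n)" "\<And>n. \<V> n \<subseteq> pre ` \<U> n" "\<Union>(\<Union>n. \<V> n) = topspace X"
    by auto
  have "\<exists>\<W>. finite \<W> \<and> \<W> \<subseteq> \<U> n \<and> \<V> n = pre ` \<W>" for n
    using finite_subset_image[OF V(1)[of n] V(2)[of n]] by auto
  then obtain \<W> where W: "\<And>n. finite (\<W> n)" "\<And>n. \<W> n \<subseteq> \<U> n" "\<And>n. \<V> n = pre ` \<W> n"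
    by metis
  have "topspace Z \<subseteq> \<Union>(\<Union>n. \<W> n)"
  proof
    fix z assume "z \<in> topspace Z"
    then obtain x where x: "x \<in> topspace X" "z = h x"
      using onto by blast
    then obtain n B where "B \<in> \<V> n" "x \<in> B"
      using V(3) by blast
    then obtain U where "U \<in> \<W> n" "h x \<in> U"
      by (auto simp: W(3) pre_def)
    then show "z \<in> \<Union>(\<Union>n. \<W> n)"
      using x(2) by auto
  qed
  moreover have "\<Union>(\<Union>n. \<W> n) \<subseteq> topspace Z"
    using W(2) U by blast
  ultimately show "\<exists>\<V>. (\<forall>n. finite (\<V> n) \<and> \<V> n \<subseteq> \<U> n) \<and> \<Union>(\<Union>n. \<V> n) = topspace Z"
    using W(1,2) by (intro exI[of _ \<W>]) simp
qed

lemma sigma_compact_space_continuous_image: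
  assumes X: "sigma_compact_space X" and h: "continuous_map X Z h"
    and onto: "h ` topspace X = topspace Z"
  shows "sigma_compact_space Z"
proof -
  obtain K :: "nat \<Rightarrow> 'a set" where K: "\<And>n. compactin X (K n)" "(\<Union>n. K n) = topspace X"
    using X unfolding sigma_compact_space_def by blast
  have "compactin Z (h ` K n)" for n
    using K(1) h by (rule image_compactin)
  moreover have "(\<Union>n. h ` K n) = topspace Z"
    unfolding image_UN[symmetric] K(2) onto ..
  ultimately show ?thesis
    unfolding sigma_compact_space_def by (intro exI[of _ "\<lambda>n. h ` K n"]) simp
qed

section \<open>Bump functions and separation of fibres\<close>

text \<open>The functions belong to centres \<open>c k\<close> from a countable dense set and radii
  \<open>r k\<close>: \<open>u k\<close> is 1 up to distance \<open>r k\<close> from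
  \<open>c k\<close> and 0 from distance \<open>2 * r k\<close> on. If \<open>N\<close> contains the
  \<epsilon>-ball around \<open>m\<close>, a radius below \<open>\<epsilon> / 3\<close> and a centre
  closer to \<open>m\<close> than this radius do.\<close>

lemma ex_bump_functions:
  assumes "metrizable_space M" "separable_space M" "topspace M \<noteq> {}"
  shows "\<exists>u :: nat \<Rightarrow> 'b \<Rightarrow> real. (\<forall>k. continuous_map M (top_of_set {0..1}) (u k)) \<and>
    (\<forall>N m. openin M N \<and> m \<in> N \<longrightarrow> (\<exists>k. u k m = 1 \<and> (\<forall>m'\<in>topspace M - N. u k m' = 0)))"
proof -
  obtain S d where "Metric_space S d" and M: "M = Metric_space.mtopology S d"
    using assms(1) unfolding metrizable_space_def by blast
  then interpret Metric_space S d
    by simp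
  obtain D where D: "countable D" "D \<subseteq> S" "mtopology closure_of D = S"
    using assms(2) unfolding separable_space_def M by auto
  have "D \<noteq> {}"
    using D(3) assms(3) by (auto simp: M)
  \<comment> \<open>\<open>prod_decode k\<close> splits \<open>k\<close> into the index of a centre
    and the index of a radius; \<open>Suc\<close> keeps the radius positive.\<close>
  define c where "c k = from_nat_into D (fst (prod_decode k))" for k
  define r where "r k = 1 / real (Suc (snd (prod_decode k)))" for k
  have c: "c k \<in> S" for k
    using from_nat_into[OF \<open>D \<noteq> {}\<close>] D(2) unfolding c_def by blast
  have r: "r k > 0" for k
    by (simp add: r_def)
  define u where "u k m = max 0 (min 1 (2 - d m (c k) / r k))" for k m
  have "continuous_map M (top_of_set {0..1}) (u k)" for k
  proof -
    have "continuous_map mtopology euclidean (\<lambda>m. d m (c k))"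
      using continuous_map_mdist[of mtopology Self "\<lambda>m. m" "\<lambda>_. c k"] c[of k]
      by (simp add: mtopology_of_def)
    then have "continuous_map mtopology euclidean (u k)"
      unfolding u_def using r[of k]
      by (intro continuous_map_real_max continuous_map_real_min continuous_map_diff
          continuous_map_real_divide continuous_map_const[THEN iffD2]) auto
    moreover have "u k m \<in> {0..1}" for m
      by (simp add: u_def)
    ultimately show ?thesis
      unfolding M continuous_map_in_subtopology by auto
  qed
  moreover have "\<exists>k. u k m = 1 \<and> (\<forall>m'\<in>topspace M - N. u k m' = 0)" if N: "openin M N" "m \<in> N" for N m
  proof -
    have m: "m \<in> S"
      using N openin_subset M by fastforce
    obtain \<epsilon> where \<epsilon>: "\<epsilon> > 0" "mball m \<epsilon> \<subseteq> N"
      using N unfolding M openin_mtopology by blast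
    obtain j where j: "1 / real (Suc j) < \<epsilon> / 3"
      using nat_approx_posE[of "\<epsilon> / 3"] \<epsilon>(1) by auto
    have "m \<in> mtopology closure_of D"
      using D(3) m by simp
    then have "\<exists>q\<in>D. q \<in> mball m (1 / real (Suc j))"
      unfolding metric_closure_of mem_Collect_eq by (elim conjE allE impE) simp_all
    then obtain q where q: "q \<in> D" "q \<in> mball m (1 / real (Suc j))"
      by blast
    obtain i where i: "from_nat_into D i = q"
      using from_nat_into_surj[OF D(1) q(1)] by blast
    let ?k = "prod_encode (i, j)"
    have k: "c ?k = q" "r ?k = 1 / real (Suc j)"
      by (simp_all add: c_def r_def i)
    have mq: "d m q < r ?k" "q \<in> S"
      using q k(2) by auto
    have "d m q / r ?k \<le> 1"
      using mq(1) r[of ?k] by (simp add: field_simps)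
    then have "u ?k m = 1"
      by (simp add: u_def k(1))
    moreover have "u ?k m' = 0" if m': "m' \<in> topspace M - N" for m'
    proof -
      have "m' \<in> S" "m' \<notin> mball m \<epsilon>"
        using m' \<epsilon>(2) M by auto
      then have "\<epsilon> \<le> d m m'"
        using m by simp
      also have "\<dots> \<le> d m q + d m' q"
        using triangle[of m q m'] commute[of m' q] m mq(2) \<open>m' \<in> S\<close> by simp
      \<comment> \<open>Here \<epsilon> exceeds \<open>3 * r ?k\<close>, and \<open>d m q\<close> is
        below \<open>r ?k\<close>.\<close>
      finally have "2 * r ?k \<le> d m' q"
        using mq(1) j k(2) by linarith
      then have "2 \<le> d m' q / r ?k"
        using r[of ?k] by (simp add: field_simps)
      then show ?thesis
        by (simp add: u_def k(1))
    qed
    ultimately show ?thesis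
      by blast
  qed
  ultimately show ?thesis
    by blast
qed

text \<open>The bump functions are pulled back along \<open>p\<close>. As \<open>p\<close> is
  closed, an open set containing a fibre contains the preimage of some open neighbourhood of the
  base point.\<close>

lemma ex_fibre_separating_functions:
  assumes M: "metrizable_space M" "separable_space M" and p: "perfect_map X M p"
    and ne: "topspace X \<noteq> {}"
  shows "\<exists>h :: nat \<Rightarrow> 'a \<Rightarrow> real. range h \<subseteq> unit_functions X \<and>
    (\<forall>x U. x \<in> topspace X \<and> openin X U \<and> {x' \<in> topspace X. p x' = p x} \<subseteq> U \<longrightarrow>
      (\<exists>k. h k x = 1 \<and> (\<forall>x'\<in>topspace X - U. h k x' = 0)))"
proof -
  have pc: "continuous_map X M p" "closed_map X M p" "p ` topspace X = topspace M"
    using p by (auto simp: perfect_map_def proper_map_def)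
  have "topspace M \<noteq> {}"
    using ne pc(3) by blast
  from ex_bump_functions[OF M this] obtain u :: "nat \<Rightarrow> 'b \<Rightarrow> real"
    where u: "\<forall>k. continuous_map M (top_of_set {0..1}) (u k)"
      and bump: "\<forall>N m. openin M N \<and> m \<in> N \<longrightarrow>
        (\<exists>k. u k m = 1 \<and> (\<forall>m'\<in>topspace M - N. u k m' = 0))"
    by (elim exE conjE)
  \<comment> \<open>The restriction to the space gives the normal form that
    \<open>unit_functions\<close> requires.\<close>
  define h where "h k = restrict (\<lambda>x. u k (p x)) (topspace X)" for k
  have "h k \<in> unit_functions X" for k
  proof -
    have "continuous_map X (top_of_set {0..1}) (u k \<circ> p)"
      using pc(1) u[rule_format] by (rule continuous_map_compose)
    then have "continuous_map X (top_of_set {0..1}) (h k)"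
      by (rule continuous_map_eq) (simp add: h_def)
    then show ?thesis
      by (simp add: unit_functions_def h_def)
  qed
  moreover have "\<exists>k. h k x = 1 \<and> (\<forall>x'\<in>topspace X - U. h k x' = 0)"
    if x: "x \<in> topspace X" and U: "openin X U" "{x' \<in> topspace X. p x' = p x} \<subseteq> U" for x U
  proof -
    let ?N = "topspace M - p ` (topspace X - U)"
    have "closedin M (p ` (topspace X - U))"
      using pc(2) U(1) unfolding closed_map_def by blast
    then have "openin M ?N"
      by blast
    moreover have "p x \<in> ?N"
      using x U(2) pc(3) by force
    ultimately obtain k where k: "u k (p x) = 1" "\<And>m'. m' \<in> topspace M - ?N \<Longrightarrow> u k m' = 0"
      using bump[rule_format, of ?N "p x"] by auto
    have "h k x' = 0" if "x' \<in> topspace X - U" for x'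
      using that k(2)[of "p x'"] pc(3) by (auto simp: h_def)
    then show ?thesis
      using k(1) x by (auto simp: h_def)
  qed
  ultimately show ?thesis
    by blast
qed

text \<open>Evaluation at \<open>f\<close> is the extension of \<open>f\<close> to the
  compactification.\<close>

lemma continuous_map_Stone_Cech_coordinate:
  assumes "f \<in> unit_functions X"
  shows "continuous_map (Stone_Cech X) euclidean (\<lambda>y. y f)"
proof -
  have "continuous_map (Stone_Cech X) (top_of_set {0..1}) (\<lambda>y. y f)"
    unfolding Stone_Cech_def unit_cube_def
    by (intro continuous_map_from_subtopology continuous_map_product_projection assms)
  then show ?thesis
    by (rule continuous_map_into_fulltopology)
qed

text \<open>The fibre of \<open>x\<close> is compact, so its image and \<open>y\<close> have
  disjoint neighbourhoods \<open>U\<close> and \<open>V\<close> in the compactification. Some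
  \<open>h k\<close> is 1 at \<open>x\<close> and 0 at all points of \<open>X\<close> that are
  mapped outside \<open>U\<close>; as \<open>y\<close> is a limit of points of \<open>X\<close>
  mapped into \<open>V\<close>, the extension of \<open>h k\<close> vanishes at
  \<open>y\<close>.\<close>

lemma Stone_Cech_coordinate_separates:
  assumes X: "completely_regular_space X" "Hausdorff_space X"
    and h: "range h \<subseteq> unit_functions X"
    and sep: "\<And>x U. x \<in> topspace X \<and> openin X U \<and> {x' \<in> topspace X. p x' = p x} \<subseteq> U \<Longrightarrow>
      \<exists>k. h k x = 1 \<and> (\<forall>x'\<in>topspace X - U. h k x' = 0)"
    and p: "perfect_map X M p" and x: "x \<in> topspace X"
    and y: "y \<in> topspace (Stone_Cech X) - beta_embedding X ` topspace X"
  shows "\<exists>k. beta_embedding X x (h k) = 1 \<and> y (h k) = 0"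
proof -
  let ?Y = "Stone_Cech X" and ?e = "beta_embedding X"
  let ?F = "{x' \<in> topspace X. p x' = p x}"
  have e: "continuous_map X ?Y ?e"
    using embedding_map_Stone_Cech[OF X] homeomorphic_imp_continuous_map
      continuous_map_into_fulltopology unfolding embedding_map_def by blast
  have eh: "?e x' (h k) = h k x'" for x' k
    using h by (auto simp: beta_embedding_def)
  have "p x \<in> topspace M"
    using p x by (auto simp: perfect_map_def)
  then have "compactin X ?F"
    using p by (simp add: perfect_map_def proper_map_def)
  then have "compactin ?Y (?e ` ?F)"
    using e by (rule image_compactin)
  moreover have "compactin ?Y {y}"
    using y by simp
  moreover have "disjnt (?e ` ?F) {y}"
    using y by auto
  ultimately obtain U V where UV: "openin ?Y U" "openin ?Y V" "?e ` ?F \<subseteq> U" "{y} \<subseteq> V" "disjnt U V"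
    by (rule Hausdorff_space_compact_separation[OF Hausdorff_space_Stone_Cech])
  obtain k where k: "h k x = 1" "\<And>x'. x' \<in> topspace X \<Longrightarrow> ?e x' \<notin> U \<Longrightarrow> h k x' = 0"
    using sep[of x "{x' \<in> topspace X. ?e x' \<in> U}"] x openin_continuous_map_preimage[OF e UV(1)] UV(3)
    by auto
  have "y (h k) = 0"
  proof (rule ccontr)
    assume "y (h k) \<noteq> 0"
    \<comment> \<open>A neighbourhood of \<open>y\<close> where the extension of \<open>h k\<close>
      has no zero; by density it contains the image of a point of \<open>X\<close>, which would lie
      in both \<open>U\<close> and \<open>V\<close>.\<close>
    let ?W = "V \<inter> {z \<in> topspace ?Y. z (h k) \<in> - {0}}"
    have "openin ?Y {z \<in> topspace ?Y. z (h k) \<in> - {0}}"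
      using h by (intro openin_continuous_map_preimage[OF continuous_map_Stone_Cech_coordinate]) auto
    then have W: "openin ?Y ?W" "y \<in> ?W"
      using UV(2,4) y \<open>y (h k) \<noteq> 0\<close> by (auto intro: openin_Int)
    have "y \<in> ?Y closure_of (?e ` topspace X)"
      using y dense_Stone_Cech by blast
    then have "\<forall>T. y \<in> T \<and> openin ?Y T \<longrightarrow> (\<exists>z. z \<in> ?e ` topspace X \<and> z \<in> T)"
      unfolding in_closure_of by (rule conjunct2)
    from this[rule_format, OF conjI[OF W(2) W(1)]] obtain x' where x': "x' \<in> topspace X" "?e x' \<in> V" "h k x' \<noteq> 0"
      using eh by auto
    then have "?e x' \<in> U"
      using k(2) by blast
    then show False
      using x'(2) UV(5) by (auto simp: disjnt_def)
  qed
  then show ?thesis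
    using k(1) eh by auto
qed

theorem theorem7p11:
  fixes X :: "'a topology" and M :: "'b topology" and p :: "'a \<Rightarrow> 'b"
  assumes "sigma_projective_determinacy"
    and "completely_regular_space X" and "Hausdorff_space X"
    and "Menger_space X"
    and "metrizable_space M" and "separable_space M" and "perfect_map X M p"
    and "class_K (Stone_Cech_remainder X)"
  shows "sigma_compact_space X"
proof (cases "topspace X = {}")
  case True
  then show ?thesis
    unfolding sigma_compact_space_def by (intro exI[of _ "\<lambda>_. {}"]) simp
next
  case False
  let ?Y = "Stone_Cech X" and ?e = "beta_embedding X"
  let ?E = "?e ` topspace X"
  obtain h :: "nat \<Rightarrow> 'a \<Rightarrow> real" where h: "range h \<subseteq> unit_functions X"
    and sep: "\<forall>x U. x \<in> topspace X \<and> openin X U \<and> {x' \<in> topspace X. p x' = p x} \<subseteq> U \<longrightarrow>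
      (\<exists>k. h k x = 1 \<and> (\<forall>x'\<in>topspace X - U. h k x' = 0))"
    using ex_fibre_separating_functions[OF assms(5-7) False] by (elim exE conjE)
  \<comment> \<open>The two closed ranges overlap, so they cover the unit interval. The value 1
    occurs only in the set for \<open>True\<close> and the value 0 only in the set for
    \<open>False\<close>, so no cell contains points with both values at some
    \<open>h k\<close>.\<close>
  define C where "C k b = {y \<in> topspace ?Y. y (h k) \<in> (if b then {1/3..} else {..2/3})}" for k b
  interpret closed_pairs ?Y C
  proof
    show "compact_space ?Y"
      by (rule compact_space_Stone_Cech)
    show "closedin ?Y (C k b)" for k b
      unfolding C_def using h
      by (intro closedin_continuous_map_preimage[OF continuous_map_Stone_Cech_coordinate]) auto
    show "C k False \<union> C k True = topspace ?Y" for k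
      by (auto simp: C_def)
  qed
  have hom: "homeomorphic_map X (subtopology ?Y ?E) ?e"
    using embedding_map_Stone_Cech[OF assms(2,3)] by (simp add: embedding_map_def)
  have E: "?E \<subseteq> topspace ?Y"
    unfolding inf.absorb_iff2 topspace_subtopology[symmetric]
    by (rule homeomorphic_imp_surjective_map[OF hom, symmetric])
  have sc: "sigma_compact_space (subtopology ?Y ?E)"
  proof (rule Menger_imp_sigma_compact[OF assms(1) E])
    show "Menger_space (subtopology ?Y ?E)"
      using assms(4) homeomorphic_imp_continuous_map[OF hom] homeomorphic_imp_surjective_map[OF hom]
      by (rule Menger_space_continuous_image)
    show "class_K (subtopology ?Y (topspace ?Y - ?E))"
      using assms(8) by (simp add: Stone_Cech_remainder_def)
    show "cell z \<subseteq> ?E \<or> cell z \<inter> ?E = {}" for z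
    proof (rule ccontr)
      assume "\<not> ?thesis"
      then obtain x y where x: "x \<in> topspace X" "?e x \<in> cell z" and y: "y \<in> cell z" "y \<notin> ?E"
        by blast
      then have "y \<in> topspace ?Y - ?E"
        using cell_subset by blast
      then obtain k where k: "?e x (h k) = 1" "y (h k) = 0"
        using Stone_Cech_coordinate_separates[OF assms(2,3) h sep[rule_format] assms(7) x(1)] by blast
      have "?e x \<in> C k (z k \<noteq> 0)" "y \<in> C k (z k \<noteq> 0)"
        using x(2) y(1) unfolding cell_def by blast+
      then show False
        using k by (auto simp: C_def split: if_splits)
    qed
  qed
  obtain g where "homeomorphic_maps X (subtopology ?Y ?E) ?e g"
    using hom homeomorphic_map_maps by blast
  then have g: "homeomorphic_map (subtopology ?Y ?E) X g"
    using homeomorphic_maps_map by blast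
  show ?thesis
    using sc homeomorphic_imp_continuous_map[OF g] homeomorphic_imp_surjective_map[OF g]
    by (rule sigma_compact_space_continuous_image)
qed

end
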